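(* Let $(M_1,g_1,J_1)$ be a metallic Riemannian manifold with $J_1^2=pJ_1+qI$, where $p,q$ are positive integers, let $(N',\phi',\xi',\eta',g')$ be an almost para-contact metric manifold, and let $F:M_1\to N'$ be a smooth map such that $F_*J_1=\phi'F_*$. If $p^2\neq(q-1)^2$, then $F$ is a constant map.
   Context: All manifolds and maps are $C^\infty$; $F_*$ is the differential of $F$. A metallic Riemannian manifold $(M,g,J)$ is a Riemannian manifold $(M,g)$ with a $(1,1)$-tensor field $J$ such that $J^2=pJ+qI$ for some positive integers $p,q$ ($I$ the identity) and $g(JX,Y)=g(X,JY)$ for all vector fields $X,Y$; it is assumed throughout that $\nabla J=0$ for the Levi-Civita connection $\nabla$ of $g$. An almost para-contact metric manifold $(N',\phi',\xi',\eta',g')$ is a $(2n+1)$-dimensional manifold $N'$ with a $(1,1)$-tensor field $\phi'$, a vector field $\xi'$, a $1$-form $\eta'$ and a pseudo-Riemannian metric $g'$ of signature $(n+1,n)$ such that $\phi'^2=I-\eta'\otimes\xi'$, $\eta'(\xi')=1$ and $g'(\phi'X,\phi'Y)=-g'(X,Y)+\eta'(X)\eta'(Y)$ for all vector fields $X,Y$; it then satisfies $\phi'(\xi')=0$, $\eta'\circ\phi'=0$, $\eta'(X)=g'(X,\xi')$, $g'(\xi',\xi')=1$ and $g'(\phi'X,Y)=-g'(\phi'Y,X)$.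
   Formalization: The manifold M_1 is additionally assumed to be connected; without this the claim fails, since a map taking different constant values on two components of M_1 satisfies all the hypotheses. *)

theory Defs
  imports "HOL-Analysis.Analysis" "HOL-Library.Function_Algebras"
begin

instantiation "fun" :: (type, real_vector) real_vector
begin

definition scaleR_fun :: "real \<Rightarrow> ('a \<Rightarrow> 'b) \<Rightarrow> 'a \<Rightarrow> 'b" where
  "scaleR_fun c f = (\<lambda>x. c *\<^sub>R f x)"

instance
  by standard (auto simp: scaleR_fun_def fun_eq_iff algebra_simps)

end


section \<open>Smooth manifolds\<close>

text \<open>On an open subset of a finite-dimensional space, \<open>smooth_on\<close> is the usual notion
  of a \<open>C\<^sup>\<infinity>\<close> map: all iterated directional derivatives exist and are differentiable.\<close>

primrec Ck_on :: "nat \<Rightarrow> 'a::real_normed_vector set \<Rightarrow> ('a \<Rightarrow> 'b::real_normed_vector) \<Rightarrow> bool" where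
  "Ck_on 0 S f \<longleftrightarrow> continuous_on S f"
| "Ck_on (Suc k) S f \<longleftrightarrow>
     (\<forall>x\<in>S. f differentiable (at x)) \<and> (\<forall>v. Ck_on k S (\<lambda>x. frechet_derivative f (at x) v))"

definition smooth_on :: "'a::real_normed_vector set \<Rightarrow> ('a \<Rightarrow> 'b::real_normed_vector) \<Rightarrow> bool" where
  "smooth_on S f \<longleftrightarrow> (\<forall>k. Ck_on k S f)"

text \<open>A chart is a pair of a domain \<open>U\<close> and a coordinate map \<open>\<phi>\<close>; only the values of
  \<open>\<phi>\<close> on \<open>U\<close> matter, and \<open>inv_into U \<phi>\<close> is the inverse parametrization.\<close>

record ('a, 'e) manifold =
  mtop :: "'a topology"
  atlas :: "('a set \<times> ('a \<Rightarrow> 'e)) set"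

abbreviation points :: "('a, 'e) manifold \<Rightarrow> 'a set" where
  "points M \<equiv> topspace (mtop M)"

text \<open>The model space is a finite-dimensional normed space of dimension \<open>m\<close>. The class
  \<open>euclidean_space\<close> would exclude \<open>m = 0\<close>.\<close>

definition smooth_manifold :: "nat \<Rightarrow> ('a, 'e::real_normed_vector) manifold \<Rightarrow> bool" where
  "smooth_manifold m M \<longleftrightarrow>
     (\<exists>B::'e set. finite B \<and> card B = m \<and> independent B \<and> span B = UNIV) \<and>
     Hausdorff_space (mtop M) \<and>
     second_countable (mtop M) \<and>
     (\<Union>(U, \<phi>)\<in>atlas M. U) = points M \<and>
     (\<forall>(U, \<phi>)\<in>atlas M. openin (mtop M) U \<and> open (\<phi> ` U) \<and>
        homeomorphic_map (subtopology (mtop M) U) (top_of_set (\<phi> ` U)) \<phi>) \<and>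
     (\<forall>(U, \<phi>)\<in>atlas M. \<forall>(V, \<psi>)\<in>atlas M. smooth_on (\<phi> ` (U \<inter> V)) (\<psi> \<circ> inv_into U \<phi>))"

definition smooth_map ::
  "('a, 'e::real_normed_vector) manifold \<Rightarrow> ('b, 'f::real_normed_vector) manifold \<Rightarrow> ('a \<Rightarrow> 'b) \<Rightarrow> bool" where
  "smooth_map M N F \<longleftrightarrow> continuous_map (mtop M) (mtop N) F \<and>
     (\<forall>(U, \<phi>)\<in>atlas M. \<forall>(V, \<psi>)\<in>atlas N.
        smooth_on (\<phi> ` {x\<in>U. F x \<in> V}) (\<psi> \<circ> F \<circ> inv_into U \<phi>))"

definition smooth_fun_on :: "('a, 'e::real_normed_vector) manifold \<Rightarrow> 'a set \<Rightarrow> ('a \<Rightarrow> real) \<Rightarrow> bool" where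
  "smooth_fun_on M W f \<longleftrightarrow> openin (mtop M) W \<and>
     (\<forall>(U, \<phi>)\<in>atlas M. smooth_on (\<phi> ` (U \<inter> W)) (f \<circ> inv_into U \<phi>))"

definition smooth_near :: "('a, 'e::real_normed_vector) manifold \<Rightarrow> 'a \<Rightarrow> ('a \<Rightarrow> real) \<Rightarrow> bool" where
  "smooth_near M x f \<longleftrightarrow> (\<exists>W. x \<in> W \<and> smooth_fun_on M W f)"


section \<open>Tangent vectors, differentials, tensor fields\<close>

text \<open>Tangent vectors at \<open>x\<close> are the derivations of the algebra of germs at \<open>x\<close> of smooth
  functions. A derivation is represented as a functional on all functions that depends only on
  germs and, so that equality of tangent vectors is equality of functionals, vanishes on functions
  that are not smooth near \<open>x\<close>. In particular \<open>tangent_space M x = {0}\<close> if \<open>x\<close> is not a point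
  of \<open>M\<close>, so that vector fields below vanish off \<open>points M\<close>.\<close>

type_synonym 'a tvec = "('a \<Rightarrow> real) \<Rightarrow> real"

definition tangent_space :: "('a, 'e::real_normed_vector) manifold \<Rightarrow> 'a \<Rightarrow> 'a tvec set" where
  "tangent_space M x = {v.
     (\<forall>f g. smooth_near M x f \<longrightarrow> smooth_near M x g \<longrightarrow>
        v (\<lambda>y. f y + g y) = v f + v g \<and>
        v (\<lambda>y. f y * g y) = f x * v g + g x * v f) \<and>
     (\<forall>c f. smooth_near M x f \<longrightarrow> v (\<lambda>y. c * f y) = c * v f) \<and>
     (\<forall>f g W. smooth_near M x f \<longrightarrow> smooth_near M x g \<longrightarrow>
        openin (mtop M) W \<longrightarrow> x \<in> W \<longrightarrow> (\<forall>y\<in>W. f y = g y) \<longrightarrow> v f = v g) \<and>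
     (\<forall>f. \<not> smooth_near M x f \<longrightarrow> v f = 0)}"

definition differential ::
  "('b, 'f::real_normed_vector) manifold \<Rightarrow> ('a \<Rightarrow> 'b) \<Rightarrow> 'a \<Rightarrow> 'a tvec \<Rightarrow> 'b tvec" where
  "differential N F x v = (\<lambda>f. if smooth_near N (F x) f then v (f \<circ> F) else 0)"

definition vector_fields :: "('a, 'e::real_normed_vector) manifold \<Rightarrow> ('a \<Rightarrow> 'a tvec) set" where
  "vector_fields M = {X. (\<forall>x. X x \<in> tangent_space M x) \<and>
     (\<forall>W f. smooth_fun_on M W f \<longrightarrow> smooth_fun_on M W (\<lambda>x. X x f))}"

definition linear_within :: "'v::real_vector set \<Rightarrow> ('v \<Rightarrow> 'w::real_vector) \<Rightarrow> bool" where
  "linear_within V h \<longleftrightarrow>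
     (\<forall>u\<in>V. \<forall>v\<in>V. \<forall>a b. h (a *\<^sub>R u + b *\<^sub>R v) = a *\<^sub>R h u + b *\<^sub>R h v)"

text \<open>Tensor fields are given pointwise on tangent spaces; smoothness is tested on smooth
  vector fields.\<close>

definition one_form :: "('a, 'e::real_normed_vector) manifold \<Rightarrow> ('a \<Rightarrow> 'a tvec \<Rightarrow> real) \<Rightarrow> bool" where
  "one_form M \<eta> \<longleftrightarrow>
     (\<forall>x\<in>points M. linear_within (tangent_space M x) (\<eta> x)) \<and>
     (\<forall>X\<in>vector_fields M. smooth_fun_on M (points M) (\<lambda>x. \<eta> x (X x)))"

definition apply_tensor :: "('a \<Rightarrow> 'a tvec \<Rightarrow> 'a tvec) \<Rightarrow> ('a \<Rightarrow> 'a tvec) \<Rightarrow> 'a \<Rightarrow> 'a tvec" where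
  "apply_tensor J X = (\<lambda>x. J x (X x))"

text \<open>The quantifier over all \<open>x\<close> is deliberate: off \<open>points M\<close> it only says \<open>J x 0 = 0\<close>.\<close>

definition tensor11 :: "('a, 'e::real_normed_vector) manifold \<Rightarrow> ('a \<Rightarrow> 'a tvec \<Rightarrow> 'a tvec) \<Rightarrow> bool" where
  "tensor11 M J \<longleftrightarrow>
     (\<forall>x. linear_within (tangent_space M x) (J x) \<and> J x ` tangent_space M x \<subseteq> tangent_space M x) \<and>
     (\<forall>X\<in>vector_fields M. apply_tensor J X \<in> vector_fields M)"

definition symmetric_tensor2 ::
  "('a, 'e::real_normed_vector) manifold \<Rightarrow> ('a \<Rightarrow> 'a tvec \<Rightarrow> 'a tvec \<Rightarrow> real) \<Rightarrow> bool" where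
  "symmetric_tensor2 M g \<longleftrightarrow>
     (\<forall>x\<in>points M. \<forall>u\<in>tangent_space M x.
        linear_within (tangent_space M x) (g x u) \<and>
        (\<forall>v\<in>tangent_space M x. g x u v = g x v u)) \<and>
     (\<forall>X\<in>vector_fields M. \<forall>Y\<in>vector_fields M. smooth_fun_on M (points M) (\<lambda>x. g x (X x) (Y x)))"

definition riemannian_metric ::
  "('a, 'e::real_normed_vector) manifold \<Rightarrow> ('a \<Rightarrow> 'a tvec \<Rightarrow> 'a tvec \<Rightarrow> real) \<Rightarrow> bool" where
  "riemannian_metric M g \<longleftrightarrow> symmetric_tensor2 M g \<and>
     (\<forall>x\<in>points M. \<forall>v\<in>tangent_space M x. v \<noteq> 0 \<longrightarrow> g x v v > 0)"

text \<open>Signature \<open>(r, s)\<close>: the tangent space has an orthonormal basis \<open>P \<union> Q\<close> with \<open>r\<close> vectors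
  of square \<open>1\<close> and \<open>s\<close> vectors of square \<open>-1\<close>.\<close>

definition pseudo_riemannian_metric ::
  "('a, 'e::real_normed_vector) manifold \<Rightarrow> nat \<Rightarrow> nat \<Rightarrow> ('a \<Rightarrow> 'a tvec \<Rightarrow> 'a tvec \<Rightarrow> real) \<Rightarrow> bool" where
  "pseudo_riemannian_metric M r s g \<longleftrightarrow> symmetric_tensor2 M g \<and>
     (\<forall>x\<in>points M. \<exists>P Q. finite P \<and> finite Q \<and> P \<inter> Q = {} \<and> card P = r \<and> card Q = s \<and>
        independent (P \<union> Q) \<and> span (P \<union> Q) = tangent_space M x \<and>
        (\<forall>e\<in>P. g x e e = 1) \<and> (\<forall>e\<in>Q. g x e e = -1) \<and>
        (\<forall>e\<in>P \<union> Q. \<forall>e'\<in>P \<union> Q. e \<noteq> e' \<longrightarrow> g x e e' = 0))"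


section \<open>The Levi-Civita connection\<close>

definition lie_bracket ::
  "('a, 'e::real_normed_vector) manifold \<Rightarrow> ('a \<Rightarrow> 'a tvec) \<Rightarrow> ('a \<Rightarrow> 'a tvec) \<Rightarrow> 'a \<Rightarrow> 'a tvec" where
  "lie_bracket M X Y = (\<lambda>x f.
     if smooth_near M x f then X x (\<lambda>y. Y y f) - Y x (\<lambda>y. X y f) else 0)"

definition fmult :: "('a \<Rightarrow> real) \<Rightarrow> ('a \<Rightarrow> 'a tvec) \<Rightarrow> 'a \<Rightarrow> 'a tvec" where
  "fmult f X = (\<lambda>x. f x *\<^sub>R X x)"

type_synonym 'a connection = "('a \<Rightarrow> 'a tvec) \<Rightarrow> ('a \<Rightarrow> 'a tvec) \<Rightarrow> 'a \<Rightarrow> 'a tvec"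

text \<open>\<open>D X Y\<close> is the covariant derivative of \<open>Y\<close> along \<open>X\<close>.\<close>

definition affine_connection :: "('a, 'e::real_normed_vector) manifold \<Rightarrow> 'a connection \<Rightarrow> bool" where
  "affine_connection M D \<longleftrightarrow>
     (\<forall>X\<in>vector_fields M. \<forall>Y\<in>vector_fields M. D X Y \<in> vector_fields M) \<and>
     (\<forall>X\<in>vector_fields M. \<forall>Y\<in>vector_fields M. \<forall>Z\<in>vector_fields M.
        D (X + Y) Z = D X Z + D Y Z \<and> D X (Y + Z) = D X Y + D X Z) \<and>
     (\<forall>X\<in>vector_fields M. \<forall>Y\<in>vector_fields M. \<forall>f. smooth_fun_on M (points M) f \<longrightarrow>
        D (fmult f X) Y = fmult f (D X Y) \<and>
        D X (fmult f Y) = fmult f (D X Y) + fmult (\<lambda>x. X x f) Y)"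

definition levi_civita ::
  "('a, 'e::real_normed_vector) manifold \<Rightarrow> ('a \<Rightarrow> 'a tvec \<Rightarrow> 'a tvec \<Rightarrow> real) \<Rightarrow> 'a connection \<Rightarrow> bool" where
  "levi_civita M g D \<longleftrightarrow> affine_connection M D \<and>
     (\<forall>X\<in>vector_fields M. \<forall>Y\<in>vector_fields M. D X Y - D Y X = lie_bracket M X Y) \<and>
     (\<forall>X\<in>vector_fields M. \<forall>Y\<in>vector_fields M. \<forall>Z\<in>vector_fields M. \<forall>x\<in>points M.
        X x (\<lambda>y. g y (Y y) (Z y)) = g x (D X Y x) (Z x) + g x (Y x) (D X Z x))"

definition cov_deriv11 ::
  "'a connection \<Rightarrow> ('a \<Rightarrow> 'a tvec \<Rightarrow> 'a tvec) \<Rightarrow> ('a \<Rightarrow> 'a tvec) \<Rightarrow> ('a \<Rightarrow> 'a tvec) \<Rightarrow> 'a \<Rightarrow> 'a tvec" where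
  "cov_deriv11 D J X Y = D X (apply_tensor J Y) - apply_tensor J (D X Y)"

definition parallel11 ::
  "('a, 'e::real_normed_vector) manifold \<Rightarrow> 'a connection \<Rightarrow> ('a \<Rightarrow> 'a tvec \<Rightarrow> 'a tvec) \<Rightarrow> bool" where
  "parallel11 M D J \<longleftrightarrow> (\<forall>X\<in>vector_fields M. \<forall>Y\<in>vector_fields M. cov_deriv11 D J X Y = 0)"


section \<open>Metallic and almost para-contact metric structures\<close>

definition metallic_riemannian ::
  "('a, 'e::real_normed_vector) manifold \<Rightarrow> ('a \<Rightarrow> 'a tvec \<Rightarrow> 'a tvec \<Rightarrow> real) \<Rightarrow>
   ('a \<Rightarrow> 'a tvec \<Rightarrow> 'a tvec) \<Rightarrow> nat \<Rightarrow> nat \<Rightarrow> bool" where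
  "metallic_riemannian M g J p q \<longleftrightarrow>
     0 < p \<and> 0 < q \<and> (\<exists>m. smooth_manifold m M) \<and> riemannian_metric M g \<and> tensor11 M J \<and>
     (\<forall>x\<in>points M. \<forall>v\<in>tangent_space M x. J x (J x v) = real p *\<^sub>R J x v + real q *\<^sub>R v) \<and>
     (\<forall>X\<in>vector_fields M. \<forall>Y\<in>vector_fields M. \<forall>x\<in>points M.
        g x (J x (X x)) (Y x) = g x (X x) (J x (Y x)))"

definition almost_paracontact_metric ::
  "nat \<Rightarrow> ('a, 'e::real_normed_vector) manifold \<Rightarrow> ('a \<Rightarrow> 'a tvec \<Rightarrow> 'a tvec) \<Rightarrow> ('a \<Rightarrow> 'a tvec) \<Rightarrow>
   ('a \<Rightarrow> 'a tvec \<Rightarrow> real) \<Rightarrow> ('a \<Rightarrow> 'a tvec \<Rightarrow> 'a tvec \<Rightarrow> real) \<Rightarrow> bool" where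
  "almost_paracontact_metric n N \<phi> \<xi> \<eta> g \<longleftrightarrow>
     smooth_manifold (2 * n + 1) N \<and> tensor11 N \<phi> \<and> \<xi> \<in> vector_fields N \<and> one_form N \<eta> \<and>
     pseudo_riemannian_metric N (n + 1) n g \<and>
     (\<forall>x\<in>points N. \<forall>v\<in>tangent_space N x. \<phi> x (\<phi> x v) = v - \<eta> x v *\<^sub>R \<xi> x) \<and>
     (\<forall>x\<in>points N. \<eta> x (\<xi> x) = 1) \<and>
     (\<forall>X\<in>vector_fields N. \<forall>Y\<in>vector_fields N. \<forall>x\<in>points N.
        g x (\<phi> x (X x)) (\<phi> x (Y x)) = - g x (X x) (Y x) + \<eta> x (X x) * \<eta> x (Y x))"

end

theory Submission
  imports Defs
begin

text \<open>
  For a tangent vector \<open>v\<close> put \<open>w = F\<^sub>* v\<close>. Intertwining gives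
  \<open>\<phi>\<^sup>2 w = p \<phi> w + q w\<close>, while \<open>\<phi>\<^sup>2 w = w - \<eta>(w) \<xi>\<close>. Applying \<open>\<eta>\<close> and using \<open>\<eta> \<circ> \<phi> = 0\<close>
  yields \<open>q \<eta>(w) = 0\<close>, so \<open>\<phi>\<^sup>2 w = w\<close> and \<open>p \<phi> w = (1 - q) w\<close>; applying \<open>\<phi>\<close> once more gives
  \<open>p\<^sup>2 w = (1 - q)\<^sup>2 w\<close>, hence \<open>w = 0\<close>. Since \<open>F\<^sub>*\<close> vanishes everywhere, \<open>F\<close> has zero derivative
  in charts, is locally constant, and is constant by connectedness.
\<close>

section \<open>Calculus of maps of class \<open>C\<^sup>k\<close>\<close>

text \<open>At a point of an open set the derivative is determined by the values on that set, so
  agreement on \<open>S\<close> passes to every directional derivative and the induction continues.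
  Openness is what keeps the arbitrary values outside \<open>S\<close> from mattering.\<close>

lemma Ck_on_cong:
  assumes "open S" "\<And>x. x \<in> S \<Longrightarrow> f x = g x" "Ck_on k S f"
  shows "Ck_on k S g"
  using assms(2,3)
proof (induction k arbitrary: f g)
  case 0
  then show ?case by (simp cong: continuous_on_cong)
next
  case (Suc k)
  have der: "(g has_derivative frechet_derivative f (at x)) (at x)" if "x \<in> S" for x
  proof (rule has_derivative_transform_within_open[OF _ assms(1) that])
    show "(f has_derivative frechet_derivative f (at x)) (at x)"
      using Suc.prems(2) that by (simp add: frechet_derivative_works[symmetric])
  qed (use Suc.prems(1) in auto)
  have "Ck_on k S (\<lambda>x. frechet_derivative g (at x) v)" for v
  proof (rule Suc.IH)
    show "Ck_on k S (\<lambda>x. frechet_derivative f (at x) v)"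
      using Suc.prems(2) by simp
    show "frechet_derivative f (at x) v = frechet_derivative g (at x) v" if "x \<in> S" for x
      using frechet_derivative_at[OF der[OF that]] by simp
  qed
  with der show ?case by (auto simp: differentiable_def)
qed

lemma Ck_on_subset: "Ck_on k S f \<Longrightarrow> T \<subseteq> S \<Longrightarrow> Ck_on k T f"
  by (induction k arbitrary: f) (auto intro: continuous_on_subset)

text \<open>\<open>Ck_on\<close> at a successor has no continuity clause for \<open>f\<close>
  itself; differentiability supplies it at the bottom level. The product and chain rules need this
  descent because their derivative formulas contain undifferentiated factors.\<close>

lemma Ck_on_SucD: "Ck_on (Suc k) S f \<Longrightarrow> Ck_on k S f"
proof (induction k arbitrary: f)
  case 0
  then show ?case
    by (auto intro!: continuous_at_imp_continuous_on differentiable_imp_continuous_within)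
next
  case (Suc k)
  have "Ck_on k S (\<lambda>x. frechet_derivative f (at x) v)" for v
    by (rule Suc.IH) (use Suc.prems in \<open>simp only: Ck_on.simps(2)[of "Suc k" S f]\<close>)
  with Suc.prems show ?case unfolding Ck_on.simps(2)[of _ S f] by blast
qed

lemma Ck_on_Suc_imp_has_derivative:
  "Ck_on (Suc k) S f \<Longrightarrow> x \<in> S \<Longrightarrow> (f has_derivative frechet_derivative f (at x)) (at x)"
  by (simp add: frechet_derivative_works[symmetric])

text \<open>Uniqueness of the derivative allows any explicit formula \<open>f'\<close> to stand in
  for the choice operator \<open>frechet_derivative\<close>. The closure properties below thereby
  reduce to the usual differentiation rules.\<close>

lemma Ck_on_SucI:
  assumes "open S" "\<And>x. x \<in> S \<Longrightarrow> (f has_derivative f' x) (at x)" "\<And>v. Ck_on k S (\<lambda>x. f' x v)"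
  shows "Ck_on (Suc k) S f"
proof -
  have "Ck_on k S (\<lambda>x. frechet_derivative f (at x) v)" for v
    using assms(1) _ assms(3)[of v]
  proof (rule Ck_on_cong)
    show "f' x v = frechet_derivative f (at x) v" if "x \<in> S" for x
      using frechet_derivative_at[OF assms(2)[OF that]] by simp
  qed
  with assms(2) show ?thesis by (auto simp: differentiable_def)
qed

section \<open>Closure of the class \<open>Ck_on\<close> under algebraic operations and
  composition\<close>

lemma Ck_on_const: "open S \<Longrightarrow> Ck_on k S (\<lambda>x. c)"
proof (induction k arbitrary: c)
  case (Suc k)
  then show ?case
    by (intro Ck_on_SucI[where f' = "\<lambda>x v. 0"]) auto
qed simp

lemma Ck_on_add:
  "open S \<Longrightarrow> Ck_on k S f \<Longrightarrow> Ck_on k S g \<Longrightarrow> Ck_on k S (\<lambda>x. f x + g x)"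
proof (induction k arbitrary: f g)
  case 0
  then show ?case by (simp add: continuous_on_add)
next
  case (Suc k)
  show ?case
  proof (rule Ck_on_SucI[OF \<open>open S\<close>])
    show "((\<lambda>x. f x + g x) has_derivative
        (\<lambda>v. frechet_derivative f (at x) v + frechet_derivative g (at x) v)) (at x)" if "x \<in> S" for x
      using Suc.prems that by (intro has_derivative_add Ck_on_Suc_imp_has_derivative)
  qed (use Suc in simp)
qed

lemma Ck_on_sum:
  assumes "open S" "finite I" "\<And>i. i \<in> I \<Longrightarrow> Ck_on k S (f i)"
  shows "Ck_on k S (\<lambda>x. \<Sum>i\<in>I. f i x)"
  using assms(2,3)
  by (induction I rule: finite_induct) (simp_all add: assms(1) Ck_on_const Ck_on_add)

lemma Ck_on_mult:
  fixes f g :: "'a::real_normed_vector \<Rightarrow> real"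
  shows "open S \<Longrightarrow> Ck_on k S f \<Longrightarrow> Ck_on k S g \<Longrightarrow> Ck_on k S (\<lambda>x. f x * g x)"
proof (induction k arbitrary: f g)
  case 0
  then show ?case by (simp add: continuous_on_mult)
next
  case (Suc k)
  show ?case
  proof (rule Ck_on_SucI[OF \<open>open S\<close>])
    show "((\<lambda>x. f x * g x) has_derivative
        (\<lambda>v. f x * frechet_derivative g (at x) v + frechet_derivative f (at x) v * g x)) (at x)"
      if "x \<in> S" for x
      using Suc.prems that by (intro has_derivative_mult Ck_on_Suc_imp_has_derivative)
    show "Ck_on k S (\<lambda>x. f x * frechet_derivative g (at x) v + frechet_derivative f (at x) v * g x)"
      for v
      using Suc.prems Ck_on_SucD[OF Suc.prems(2)] Ck_on_SucD[OF Suc.prems(3)]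
      by (intro Ck_on_add Suc.IH) simp_all
  qed
qed

lemma Ck_on_bounded_linear:
  assumes "bounded_linear L"
  shows "open S \<Longrightarrow> Ck_on k S f \<Longrightarrow> Ck_on k S (\<lambda>x. L (f x))"
proof (induction k arbitrary: f)
  case 0
  then show ?case by (simp add: bounded_linear.continuous_on[OF assms])
next
  case (Suc k)
  show ?case
  proof (rule Ck_on_SucI[OF \<open>open S\<close>])
    show "((\<lambda>x. L (f x)) has_derivative (\<lambda>v. L (frechet_derivative f (at x) v))) (at x)"
      if "x \<in> S" for x
      using Suc.prems that
      by (intro bounded_linear.has_derivative[OF assms] Ck_on_Suc_imp_has_derivative)
  qed (use Suc in simp)
qed

text \<open>The chain rule produces \<open>f' (h x) (h' x v)\<close>, whose direction varies with
  \<open>x\<close>, while \<open>Ck_on\<close> controls derivatives in fixed directions only.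
  Expanding \<open>h' x v\<close> along \<open>Basis\<close> turns this into a finite sum of
  products of scalar functions, each of class \<open>k\<close>; this is where the Euclidean model
  space of the target enters.\<close>

lemma Ck_on_compose:
  fixes h :: "'a::real_normed_vector \<Rightarrow> 'b::euclidean_space" and f :: "'b \<Rightarrow> real"
  assumes "open S" "h ` S \<subseteq> T"
  shows "Ck_on k S h \<Longrightarrow> Ck_on k T f \<Longrightarrow> Ck_on k S (\<lambda>x. f (h x))"
proof (induction k arbitrary: f)
  case 0
  then show ?case
    using continuous_on_compose2[of T f S h] assms(2) by simp
next
  case (Suc k)
  define h' where "h' = (\<lambda>x. frechet_derivative h (at x))"
  define f' where "f' = (\<lambda>y. frechet_derivative f (at y))"
  have f': "(f has_derivative f' (h x)) (at (h x))" if "x \<in> S" for x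
    using Suc.prems(2) that assms(2) unfolding f'_def
    by (blast intro: Ck_on_Suc_imp_has_derivative)
  have h': "(h has_derivative h' x) (at x)" if "x \<in> S" for x
    using Suc.prems(1) that unfolding h'_def by (rule Ck_on_Suc_imp_has_derivative)
  show ?case
  proof (rule Ck_on_SucI[OF assms(1)])
    show "((\<lambda>x. f (h x)) has_derivative (\<lambda>v. \<Sum>b\<in>Basis. (h' x v \<bullet> b) * f' (h x) b)) (at x)"
      if "x \<in> S" for x
    proof -
      have lin: "linear (f' (h x))"
        using f'[OF that] by (rule has_derivative_linear)
      have "f' (h x) (h' x v) = (\<Sum>b\<in>Basis. (h' x v \<bullet> b) * f' (h x) b)" for v
      proof -
        have "f' (h x) (h' x v) = f' (h x) (\<Sum>b\<in>Basis. (h' x v \<bullet> b) *\<^sub>R b)"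
          by (simp add: euclidean_representation)
        also have "\<dots> = (\<Sum>b\<in>Basis. (h' x v \<bullet> b) * f' (h x) b)"
          by (simp add: linear_sum[OF lin] linear_cmul[OF lin])
        finally show ?thesis .
      qed
      with has_derivative_compose[OF h'[OF that] f'[OF that]] show ?thesis by simp
    qed
    show "Ck_on k S (\<lambda>x. \<Sum>b\<in>Basis. (h' x v \<bullet> b) * f' (h x) b)" for v
    proof (intro Ck_on_sum Ck_on_mult assms(1) finite_Basis)
      show "Ck_on k S (\<lambda>x. h' x v \<bullet> b)" for b
        using Suc.prems(1) unfolding h'_def
        by (intro Ck_on_bounded_linear[OF bounded_linear_inner_left] assms(1)) simp
      show "Ck_on k S (\<lambda>x. f' (h x) b)" for b
        using Suc.prems Ck_on_SucD[OF Suc.prems(1)] unfolding f'_def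
        by (intro Suc.IH) simp_all
    qed
  qed
qed

lemma smooth_on_differentiable:
  "smooth_on S f \<Longrightarrow> x \<in> S \<Longrightarrow> f differentiable (at x)"
  unfolding smooth_on_def by (drule spec[of _ "Suc 0"]) simp


section \<open>Charts and smooth functions\<close>

lemma chart_open_image:
  assumes "smooth_manifold m M" "(U, \<phi>) \<in> atlas M" "openin (mtop M) W"
  shows "open (\<phi> ` (U \<inter> W))"
proof -
  have hom: "homeomorphic_map (subtopology (mtop M) U) (top_of_set (\<phi> ` U)) \<phi>"
    and "open (\<phi> ` U)"
    using assms(1,2) by (auto simp: smooth_manifold_def)
  have "openin (subtopology (mtop M) U) (U \<inter> W)"
    using assms(3) by (simp add: openin_subtopology_Int2)
  then have "openin (top_of_set (\<phi> ` U)) (\<phi> ` (U \<inter> W))"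
    using homeomorphic_imp_open_map[OF hom] by (simp add: open_map_def)
  then show ?thesis
    using \<open>open (\<phi> ` U)\<close> openin_open_trans by blast
qed

lemma chart_inj_on:
  assumes "smooth_manifold m M" "(U, \<phi>) \<in> atlas M"
  shows "inj_on \<phi> U"
proof -
  have hom: "homeomorphic_map (subtopology (mtop M) U) (top_of_set (\<phi> ` U)) \<phi>"
    and "openin (mtop M) U"
    using assms by (auto simp: smooth_manifold_def)
  then show ?thesis
    using homeomorphic_imp_injective_map[OF hom] openin_subset[of "mtop M" U]
    by (simp add: Int_absorb1)
qed

lemma chart_openin:
  assumes "smooth_manifold m M" "(U, \<phi>) \<in> atlas M"
  shows "openin (mtop M) U"
  using assms by (auto simp: smooth_manifold_def)

lemma chart_open_preimage:
  assumes "smooth_manifold m M" "(U, \<phi>) \<in> atlas M" "open B"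
  shows "openin (mtop M) {x \<in> U. \<phi> x \<in> B}"
proof -
  have hom: "homeomorphic_map (subtopology (mtop M) U) (top_of_set (\<phi> ` U)) \<phi>"
    and U: "openin (mtop M) U"
    using assms by (auto simp: smooth_manifold_def)
  have "openin (subtopology (mtop M) U)
      {x \<in> topspace (subtopology (mtop M) U). \<phi> x \<in> \<phi> ` U \<inter> B}"
    using homeomorphic_imp_continuous_map[OF hom] assms(3)
    by (intro openin_continuous_map_preimage) auto
  moreover have "{x \<in> topspace (subtopology (mtop M) U). \<phi> x \<in> \<phi> ` U \<inter> B} = {x \<in> U. \<phi> x \<in> B}"
    using openin_subset[OF U] by auto
  ultimately show ?thesis
    using U openin_trans_full by fastforce
qed

lemma obtain_chart:
  assumes "smooth_manifold m M" "x \<in> points M"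
  obtains U \<phi> where "(U, \<phi>) \<in> atlas M" "x \<in> U"
  using assms unfolding smooth_manifold_def by blast

section \<open>Germs of smooth functions and their pullback\<close>

lemma smooth_near_imp_differentiable:
  assumes M: "smooth_manifold m M" and ch: "(U, \<phi>) \<in> atlas M" "x \<in> U"
    and f: "smooth_near M x f"
  shows "(f \<circ> inv_into U \<phi>) differentiable (at (\<phi> x))"
proof -
  obtain W where "x \<in> W" "smooth_fun_on M W f"
    using f by (auto simp: smooth_near_def)
  then have "smooth_on (\<phi> ` (U \<inter> W)) (f \<circ> inv_into U \<phi>)" "\<phi> x \<in> \<phi> ` (U \<inter> W)"
    using ch by (auto simp: smooth_fun_on_def)
  then show ?thesis by (rule smooth_on_differentiable)
qed

lemma smooth_fun_on_imp_Ck_on: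
  assumes "smooth_fun_on M W f" "(U, \<phi>) \<in> atlas M"
  shows "Ck_on k (\<phi> ` (U \<inter> W)) (f \<circ> inv_into U \<phi>)"
  using assms unfolding smooth_fun_on_def smooth_on_def by blast

text \<open>A common argument for sums and products of germs: both functions are smooth on the
  intersection of their domains, and in each chart the claim is a closure property of
  \<open>Ck_on\<close>.\<close>

lemma smooth_near_binop:
  assumes M: "smooth_manifold m M"
    and op: "\<And>k S (f::'e::real_normed_vector \<Rightarrow> real) g.
      open S \<Longrightarrow> Ck_on k S f \<Longrightarrow> Ck_on k S g \<Longrightarrow> Ck_on k S (\<lambda>x. op (f x) (g x))"
    and f: "smooth_near (M :: ('a, 'e) manifold) x f" and g: "smooth_near M x g"
  shows "smooth_near M x (\<lambda>y. op (f y) (g y))"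
proof -
  obtain W W' where W: "x \<in> W" "smooth_fun_on M W f" and W': "x \<in> W'" "smooth_fun_on M W' g"
    using f g by (auto simp: smooth_near_def)
  have o: "openin (mtop M) (W \<inter> W')"
    using W W' by (auto simp: smooth_fun_on_def)
  have "Ck_on k (\<phi> ` (U \<inter> (W \<inter> W'))) (\<lambda>y. op ((f \<circ> inv_into U \<phi>) y) ((g \<circ> inv_into U \<phi>) y))"
    if ch: "(U, \<phi>) \<in> atlas M" for U \<phi> k
  proof (rule op[OF chart_open_image[OF M ch o]])
    show "Ck_on k (\<phi> ` (U \<inter> (W \<inter> W'))) (f \<circ> inv_into U \<phi>)"
      by (rule Ck_on_subset[OF smooth_fun_on_imp_Ck_on[OF W(2) ch]]) blast
    show "Ck_on k (\<phi> ` (U \<inter> (W \<inter> W'))) (g \<circ> inv_into U \<phi>)"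
      by (rule Ck_on_subset[OF smooth_fun_on_imp_Ck_on[OF W'(2) ch]]) blast
  qed
  then have "smooth_fun_on M (W \<inter> W') (\<lambda>y. op (f y) (g y))"
    using o by (auto simp: smooth_fun_on_def smooth_on_def o_def)
  with W W' show ?thesis by (auto simp: smooth_near_def)
qed

lemma smooth_near_const:
  assumes M: "smooth_manifold m M" and "x \<in> points M"
  shows "smooth_near M x (\<lambda>y. c)"
proof -
  have "Ck_on k (\<phi> ` (U \<inter> points M)) ((\<lambda>y. c) \<circ> inv_into U \<phi>)" if "(U, \<phi>) \<in> atlas M" for U \<phi> k
    unfolding o_def by (rule Ck_on_const[OF chart_open_image[OF M that openin_topspace]])
  then have "smooth_fun_on M (points M) (\<lambda>y. c)"
    unfolding smooth_fun_on_def smooth_on_def by blast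
  with assms(2) show ?thesis unfolding smooth_near_def by blast
qed

lemma smooth_near_imp_point:
  assumes "smooth_near M x f" shows "x \<in> points M"
  using assms openin_subset unfolding smooth_near_def smooth_fun_on_def by blast

lemma smooth_near_add:
  assumes "smooth_manifold m M" "smooth_near M x f" "smooth_near M x g"
  shows "smooth_near M x (\<lambda>y. f y + g y)"
  by (rule smooth_near_binop[OF assms(1) Ck_on_add assms(2,3)])

lemma smooth_near_mult:
  assumes "smooth_manifold m M" "smooth_near M x f" "smooth_near M x g"
  shows "smooth_near M x (\<lambda>y. f y * g y)"
  by (rule smooth_near_binop[OF assms(1) Ck_on_mult assms(2,3)])

lemma smooth_near_cmult:
  assumes "smooth_manifold m M" "smooth_near M x f"
  shows "smooth_near M x (\<lambda>y. c * f y)"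
  using assms(1) smooth_near_const[OF assms(1) smooth_near_imp_point[OF assms(2)]] assms(2)
  by (rule smooth_near_mult)

lemma smooth_near_compose:
  fixes M :: "('a, 'e::real_normed_vector) manifold" and N :: "('b, 'f::euclidean_space) manifold"
  assumes M: "smooth_manifold m M" and N: "smooth_manifold n N" and F: "smooth_map M N F"
    and x: "x \<in> points M" and f: "smooth_near N (F x) f"
  shows "smooth_near M x (f \<circ> F)"
proof -
  obtain W where W: "F x \<in> W" "smooth_fun_on N W f"
    using f by (auto simp: smooth_near_def)
  obtain V \<psi> where V: "(V, \<psi>) \<in> atlas N" "F x \<in> V"
    using obtain_chart[OF N smooth_near_imp_point[OF f]] .
  \<comment> \<open>On \<open>W'\<close> the map \<open>F\<close> stays inside one chart domain
    \<open>V\<close>, so a single chart of \<open>N\<close> suffices to factor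
    \<open>f \<circ> F\<close> as \<open>f \<circ> inv_into V \<psi>\<close> after the coordinate
    form of \<open>F\<close>, in every chart of \<open>M\<close>.\<close>
  define W' where "W' = {y \<in> points M. F y \<in> V \<inter> W}"
  have cont: "continuous_map (mtop M) (mtop N) F"
    using F by (simp add: smooth_map_def)
  have W': "openin (mtop M) W'"
    unfolding W'_def using W(2) chart_openin[OF N V(1)]
    by (intro openin_continuous_map_preimage[OF cont]) (auto simp: smooth_fun_on_def)
  have "Ck_on k (\<phi> ` (U \<inter> W')) (f \<circ> F \<circ> inv_into U \<phi>)" if ch: "(U, \<phi>) \<in> atlas M" for U \<phi> k
  proof (rule Ck_on_cong[OF chart_open_image[OF M ch W']])
    let ?h = "\<psi> \<circ> F \<circ> inv_into U \<phi>"
    have inv: "inv_into U \<phi> (\<phi> y) = y" if "y \<in> U" for y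
      using that chart_inj_on[OF M ch] by simp
    have "Ck_on k (\<phi> ` {y \<in> U. F y \<in> V}) ?h"
      using F ch V(1) unfolding smooth_map_def smooth_on_def by blast
    then have h: "Ck_on k (\<phi> ` (U \<inter> W')) ?h"
      by (rule Ck_on_subset) (auto simp: W'_def)
    have "Ck_on k (\<psi> ` (V \<inter> W)) (f \<circ> inv_into V \<psi>)"
      by (rule smooth_fun_on_imp_Ck_on[OF W(2) V(1)])
    then have "Ck_on k (\<phi> ` (U \<inter> W')) (\<lambda>y. (f \<circ> inv_into V \<psi>) (?h y))"
      if "?h ` \<phi> ` (U \<inter> W') \<subseteq> \<psi> ` (V \<inter> W)"
      by (rule Ck_on_compose[OF chart_open_image[OF M ch W'] that h])
    moreover have "?h ` \<phi> ` (U \<inter> W') \<subseteq> \<psi> ` (V \<inter> W)"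
      by (auto simp: inv W'_def)
    ultimately show "Ck_on k (\<phi> ` (U \<inter> W')) (\<lambda>y. (f \<circ> inv_into V \<psi>) (?h y))"
      by blast
    show "(f \<circ> inv_into V \<psi>) (?h y) = (f \<circ> F \<circ> inv_into U \<phi>) y" if "y \<in> \<phi> ` (U \<inter> W')" for y
    proof -
      obtain z where z: "z \<in> U" "z \<in> W'" "y = \<phi> z" using \<open>y \<in> \<phi> ` (U \<inter> W')\<close> by blast
      then have "F z \<in> V" by (simp add: W'_def)
      with z show ?thesis using chart_inj_on[OF N V(1)] by (simp add: inv)
    qed
  qed
  then have "smooth_fun_on M W' (f \<circ> F)"
    using W' by (auto simp: smooth_fun_on_def smooth_on_def)
  moreover have "x \<in> W'"
    using x V(2) W(1) by (simp add: W'_def)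
  ultimately show ?thesis by (auto simp: smooth_near_def)
qed


section \<open>Tangent vectors and differentials\<close>

text \<open>It suffices that \<open>d\<close> behaves as a derivation on smooth germs: these are
  closed under the operations involved, so the truncation to the default value 0 never interferes
  with the derivation laws.\<close>

lemma tangent_spaceI:
  fixes M :: "('a, 'e::real_normed_vector) manifold"
  assumes M: "smooth_manifold m M"
    and "\<And>f g. smooth_near M x f \<Longrightarrow> smooth_near M x g \<Longrightarrow> d (\<lambda>y. f y + g y) = d f + d g"
    and "\<And>f g. smooth_near M x f \<Longrightarrow> smooth_near M x g \<Longrightarrow>
      d (\<lambda>y. f y * g y) = f x * d g + g x * d f"
    and "\<And>c f. smooth_near M x f \<Longrightarrow> d (\<lambda>y. c * f y) = c * d f"
    and "\<And>f g W. smooth_near M x f \<Longrightarrow> smooth_near M x g \<Longrightarrow> openin (mtop M) W \<Longrightarrow> x \<in> W \<Longrightarrow>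
      \<forall>y\<in>W. f y = g y \<Longrightarrow> d f = d g"
  shows "(\<lambda>f. if smooth_near M x f then d f else 0) \<in> tangent_space M x"
  unfolding tangent_space_def mem_Collect_eq
proof (intro conjI allI impI)
  fix f g W
  assume "smooth_near M x f" "smooth_near M x g" "openin (mtop M) W" "x \<in> W" "\<forall>y\<in>W. f y = g y"
  with assms(5)[OF this]
  show "(if smooth_near M x f then d f else 0) = (if smooth_near M x g then d g else 0)"
    by (simp only: if_True)
qed (simp_all add: assms(2-4) smooth_near_add[OF M] smooth_near_mult[OF M] smooth_near_cmult[OF M])

text \<open>Pullback along \<open>F\<close> preserves smooth germs and commutes with their algebraic
  operations, so the laws for \<open>v\<close> transfer. Locality uses that the preimage of a
  neighbourhood of \<open>F x\<close> is a neighbourhood of \<open>x\<close>.\<close>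

lemma differential_in_tangent_space:
  fixes M :: "('a, 'e::real_normed_vector) manifold" and N :: "('b, 'f::euclidean_space) manifold"
  assumes M: "smooth_manifold m M" and N: "smooth_manifold n N" and F: "smooth_map M N F"
    and x: "x \<in> points M" and v: "v \<in> tangent_space M x"
  shows "differential N F x v \<in> tangent_space N (F x)"
proof -
  note near = smooth_near_compose[OF M N F x]
  show ?thesis
    unfolding differential_def
  proof (rule tangent_spaceI[OF N])
    fix f g assume fg: "smooth_near N (F x) f" "smooth_near N (F x) g"
    show "v ((\<lambda>y. f y + g y) \<circ> F) = v (f \<circ> F) + v (g \<circ> F)"
      "v ((\<lambda>y. f y * g y) \<circ> F) = f (F x) * v (g \<circ> F) + g (F x) * v (f \<circ> F)"
      using v near[OF fg(1)] near[OF fg(2)] by (simp_all add: tangent_space_def o_def)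
    fix W assume W: "openin (mtop N) W" "F x \<in> W" "\<forall>y\<in>W. f y = g y"
    have "openin (mtop M) {y \<in> points M. F y \<in> W}"
      using F W(1) by (intro openin_continuous_map_preimage) (auto simp: smooth_map_def)
    moreover have "x \<in> {y \<in> points M. F y \<in> W}" using x W(2) by simp
    moreover have "\<forall>y\<in>{y \<in> points M. F y \<in> W}. (f \<circ> F) y = (g \<circ> F) y" using W(3) by simp
    ultimately show "v (f \<circ> F) = v (g \<circ> F)"
      using v near[OF fg(1)] near[OF fg(2)] unfolding tangent_space_def by blast
  next
    fix c f assume "smooth_near N (F x) f"
    from near[OF this] show "v ((\<lambda>y. c * f y) \<circ> F) = c * v (f \<circ> F)"
      using v by (simp add: tangent_space_def o_def)
  qed
qed

text \<open>The coordinate vector at \<open>x\<close> in direction \<open>e\<close>, a partial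
  derivative when \<open>e\<close> is a basis vector; the value 0 on other functions follows the
  convention of \<open>tangent_space\<close>.\<close>

definition chart_vector ::
  "('a, 'e::real_normed_vector) manifold \<Rightarrow> 'a set \<Rightarrow> ('a \<Rightarrow> 'e) \<Rightarrow> 'a \<Rightarrow> 'e \<Rightarrow> 'a tvec" where
  "chart_vector M U \<phi> x e = (\<lambda>f. if smooth_near M x f
     then frechet_derivative (f \<circ> inv_into U \<phi>) (at (\<phi> x)) e else 0)"

lemma chart_vector_in_tangent_space:
  assumes M: "smooth_manifold m M" and ch: "(U, \<phi>) \<in> atlas M" "x \<in> U"
  shows "chart_vector M U \<phi> x e \<in> tangent_space M x"
proof -
  define D where "D = (\<lambda>f :: 'a \<Rightarrow> real. frechet_derivative (f \<circ> inv_into U \<phi>) (at (\<phi> x)))"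
  have D: "((\<lambda>y. f (inv_into U \<phi> y)) has_derivative D f) (at (\<phi> x))" if "smooth_near M x f" for f
    using smooth_near_imp_differentiable[OF M ch that]
    by (simp add: D_def frechet_derivative_works[symmetric] o_def)
  have D_unique: "D f = d" if "((\<lambda>y. f (inv_into U \<phi> y)) has_derivative d) (at (\<phi> x))" for f d
    using frechet_derivative_at[OF that] by (simp add: D_def o_def)
  have inv: "inv_into U \<phi> (\<phi> y) = y" if "y \<in> U" for y
    using that chart_inj_on[OF M ch(1)] by simp
  have "D (\<lambda>y. f y + g y) e = D f e + D g e"
    "D (\<lambda>y. f y * g y) e = f x * D g e + g x * D f e"
    if "smooth_near M x f" "smooth_near M x g" for f g
    using fun_cong[OF D_unique[of "\<lambda>y. f y + g y", OF has_derivative_add[OF D D]], OF that, of e]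
      fun_cong[OF D_unique[of "\<lambda>y. f y * g y", OF has_derivative_mult[OF D D]], OF that, of e]
    by (simp_all add: inv ch(2) mult.commute)
  moreover have "D (\<lambda>y. c * f y) e = c * D f e" if "smooth_near M x f" for c f
    using fun_cong[OF D_unique[of "\<lambda>y. c * f y", OF has_derivative_mult_right[OF D]], OF that, of e] .
  moreover have "D f e = D g e"
    if f: "smooth_near M x f" and W: "openin (mtop M) W" "x \<in> W" and eq: "\<forall>y\<in>W. f y = g y" for f g W
  proof -
    \<comment> \<open>Agreement on \<open>W\<close> gives agreement of the coordinate forms on the
      open image of \<open>U \<inter> W\<close>, so the derivative of one is also a derivative of
      the other.\<close>
    have "((\<lambda>y. g (inv_into U \<phi> y)) has_derivative D f) (at (\<phi> x))"
      by (rule has_derivative_transform_within_open[OF D[OF f] chart_open_image[OF M ch(1) W(1)]])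
        (use W(2) eq ch(2) inv in auto)
    then show ?thesis by (simp add: D_unique)
  qed
  ultimately show ?thesis
    unfolding chart_vector_def fun_cong[OF D_def[symmetric]]
    by (intro tangent_spaceI[OF M]) blast+
qed

section \<open>Maps with vanishing differential are constant\<close>

lemma smooth_near_chart_component:
  fixes N :: "('b, 'f::euclidean_space) manifold"
  assumes N: "smooth_manifold n N" and V: "(V, \<psi>) \<in> atlas N" "y \<in> V"
  shows "smooth_near N y (\<lambda>z. \<psi> z \<bullet> b)"
proof -
  have "Ck_on k (\<phi> ` (U \<inter> V)) ((\<lambda>z. \<psi> z \<bullet> b) \<circ> inv_into U \<phi>)" if ch: "(U, \<phi>) \<in> atlas N" for U \<phi> k
  proof -
    \<comment> \<open>Smoothness of the coordinate functions comes from smoothness of the chart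
      transitions.\<close>
    have "Ck_on k (\<phi> ` (U \<inter> V)) (\<psi> \<circ> inv_into U \<phi>)"
      using N V(1) ch unfolding smooth_manifold_def smooth_on_def by blast
    from Ck_on_bounded_linear[OF bounded_linear_inner_left
        chart_open_image[OF N ch chart_openin[OF N V(1)]] this, of b]
    show ?thesis by (simp add: o_def)
  qed
  then have "smooth_fun_on N V (\<lambda>z. \<psi> z \<bullet> b)"
    using chart_openin[OF N V(1)] by (auto simp: smooth_fun_on_def smooth_on_def)
  with V(2) show ?thesis by (auto simp: smooth_near_def)
qed

text \<open>Testing the images of coordinate vectors on coordinate functions of \<open>N\<close>
  recovers all partial derivatives of the coordinate form \<open>h\<close> of \<open>F\<close>.
  These vanish, so \<open>h\<close> is constant on a ball, and injectivity of \<open>\<psi>\<close>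
  carries this back to \<open>F\<close>.\<close>

lemma differential_zero_imp_locally_constant:
  fixes M :: "('a, 'e::real_normed_vector) manifold" and N :: "('b, 'f::euclidean_space) manifold"
  assumes M: "smooth_manifold m M" and N: "smooth_manifold n N" and F: "smooth_map M N F"
    and zero: "\<And>x v. x \<in> points M \<Longrightarrow> v \<in> tangent_space M x \<Longrightarrow> differential N F x v = 0"
    and x: "x \<in> points M"
  obtains T where "openin (mtop M) T" "x \<in> T" "\<And>y. y \<in> T \<Longrightarrow> F y = F x"
proof -
  have cont: "continuous_map (mtop M) (mtop N) F"
    using F by (simp add: smooth_map_def)
  obtain U \<phi> where U: "(U, \<phi>) \<in> atlas M" "x \<in> U"
    using obtain_chart[OF M x] .
  have "F x \<in> points N"
    using cont x by (auto simp: continuous_map_def)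
  then obtain V \<psi> where V: "(V, \<psi>) \<in> atlas N" "F x \<in> V"
    using obtain_chart[OF N] by blast
  define h where "h = \<psi> \<circ> F \<circ> inv_into U \<phi>"
  define W where "W = {y \<in> points M. F y \<in> V}"
  have inv: "inv_into U \<phi> (\<phi> y) = y" if "y \<in> U" for y
    using that chart_inj_on[OF M U(1)] by simp
  have W: "openin (mtop M) W"
    unfolding W_def using chart_openin[OF N V(1)]
    by (intro openin_continuous_map_preimage[OF cont])
  have UW: "U \<inter> W = {y \<in> U. F y \<in> V}"
    using openin_subset[OF chart_openin[OF M U(1)]] by (auto simp: W_def)
  have h_diff: "(h has_derivative frechet_derivative h (at a)) (at a)" if "a \<in> \<phi> ` (U \<inter> W)" for a
  proof -
    have "smooth_on (\<phi> ` (U \<inter> W)) h"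
      using F U(1) V(1) unfolding UW h_def smooth_map_def by blast
    from smooth_on_differentiable[OF this that] show ?thesis
      by (simp add: frechet_derivative_works[symmetric])
  qed
  have h_zero: "(h has_derivative (\<lambda>e. 0)) (at (\<phi> y))" if y: "y \<in> U \<inter> W" for y
  proof -
    \<comment> \<open>This number is the differential of \<open>F\<close>, applied to the coordinate
      vector in direction \<open>e\<close> and evaluated at the coordinate function
      \<open>?f\<close>.\<close>
    have "frechet_derivative h (at (\<phi> y)) e \<bullet> b = 0" for e b
    proof -
      let ?f = "\<lambda>z. \<psi> z \<bullet> b"
      have y': "y \<in> points M" "F y \<in> V" using y by (auto simp: W_def)
      have near: "smooth_near N (F y) ?f"
        by (rule smooth_near_chart_component[OF N V(1) y'(2)])
      have "((?f \<circ> F \<circ> inv_into U \<phi>) has_derivative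
          (\<lambda>e. frechet_derivative h (at (\<phi> y)) e \<bullet> b)) (at (\<phi> y))"
        using has_derivative_inner_left[OF h_diff[of "\<phi> y"], of b] y
        by (simp add: h_def o_def)
      from frechet_derivative_at[OF this]
      have "frechet_derivative h (at (\<phi> y)) e \<bullet> b
          = frechet_derivative (?f \<circ> F \<circ> inv_into U \<phi>) (at (\<phi> y)) e"
        by (rule fun_cong)
      also have "\<dots> = chart_vector M U \<phi> y e (?f \<circ> F)"
        using smooth_near_compose[OF M N F y'(1) near] by (simp add: chart_vector_def)
      also have "\<dots> = differential N F y (chart_vector M U \<phi> y e) ?f"
        using near by (simp add: differential_def)
      also have "\<dots> = 0"
        using zero[OF y'(1) chart_vector_in_tangent_space[OF M U(1)]] y by simp
      finally show ?thesis .
    qed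
    then have "frechet_derivative h (at (\<phi> y)) = (\<lambda>e. 0)"
      by (metis ext inner_eq_zero_iff)
    then show ?thesis using h_diff[of "\<phi> y"] y by simp
  qed
  have "\<phi> x \<in> \<phi> ` (U \<inter> W)" using U(2) x V(2) by (auto simp: W_def)
  \<comment> \<open>A ball is convex, and this one lies where the derivative of \<open>h\<close> is
    known to vanish.\<close>
  then obtain r where r: "0 < r" "ball (\<phi> x) r \<subseteq> \<phi> ` (U \<inter> W)"
    using chart_open_image[OF M U(1) W] by (meson open_contains_ball)
  have "\<exists>c. \<forall>a\<in>ball (\<phi> x) r. h a = c"
  proof (rule has_derivative_zero_constant[OF convex_ball])
    fix a assume "a \<in> ball (\<phi> x) r"
    then obtain y where "y \<in> U \<inter> W" "a = \<phi> y" using r(2) by blast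
    with h_zero show "(h has_derivative (\<lambda>e. 0)) (at a within ball (\<phi> x) r)"
      by (blast intro: has_derivative_at_withinI)
  qed
  then have h_const: "h a = h (\<phi> x)" if "a \<in> ball (\<phi> x) r" for a
    using that r(1) by (metis centre_in_ball)
  show ?thesis
  proof (rule that)
    show "openin (mtop M) {y \<in> U. \<phi> y \<in> ball (\<phi> x) r}"
      by (rule chart_open_preimage[OF M U(1) open_ball])
    show "x \<in> {y \<in> U. \<phi> y \<in> ball (\<phi> x) r}" using U(2) r(1) by simp
    show "F y = F x" if y: "y \<in> {y \<in> U. \<phi> y \<in> ball (\<phi> x) r}" for y
    proof -
      \<comment> \<open>Injectivity of \<open>\<phi>\<close> on \<open>U\<close> yields
        \<open>y \<in> W\<close>, hence \<open>F y \<in> V\<close>, the domain on which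
        \<open>\<psi>\<close> is injective.\<close>
      have "\<phi> y \<in> \<phi> ` (U \<inter> W)" using r(2) y by blast
      then have "y \<in> W"
        using y chart_inj_on[OF M U(1)] by (auto simp: inj_on_def)
      moreover have "\<psi> (F y) = \<psi> (F x)"
        using h_const[of "\<phi> y"] y U(2) by (simp add: h_def inv)
      ultimately show ?thesis
        using chart_inj_on[OF N V(1)] V(2) by (auto simp: W_def inj_on_def)
    qed
  qed
qed

text \<open>For a locally constant map every condition on the value cuts out an open set. Being
  equal to and being different from one fixed value thus split the space into two disjoint open
  sets, the first nonempty.\<close>

lemma connected_space_locally_constant:
  assumes "connected_space X"
    and loc: "\<And>x. x \<in> topspace X \<Longrightarrow> \<exists>T. openin X T \<and> x \<in> T \<and> (\<forall>y\<in>T. F y = F x)"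
  shows "F constant_on topspace X"
proof (cases "topspace X = {}")
  case False
  then obtain x where x: "x \<in> topspace X" by blast
  have "openin X {y \<in> topspace X. P (F y)}" for P
  proof (subst openin_subopen, clarify)
    fix y assume y: "y \<in> topspace X" "P (F y)"
    obtain T where "openin X T" "y \<in> T" "\<forall>z\<in>T. F z = F y"
      using loc[OF y(1)] by blast
    then show "\<exists>T. openin X T \<and> y \<in> T \<and> T \<subseteq> {y \<in> topspace X. P (F y)}"
      using y openin_subset by (intro exI[of _ T]) fastforce
  qed
  from this[of "\<lambda>z. z = F x"] this[of "\<lambda>z. z \<noteq> F x"]
  have "{y \<in> topspace X. F y \<noteq> F x} = {}"
    using assms(1) x unfolding connected_space_def by blast
  then show ?thesis by (auto simp: constant_on_def)
qed (simp add: constant_on_def)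

lemma constant_on_if_differential_zero:
  fixes M :: "('a, 'e::real_normed_vector) manifold" and N :: "('b, 'f::euclidean_space) manifold"
  assumes "smooth_manifold m M" "smooth_manifold n N" "smooth_map M N F"
    and "connected_space (mtop M)"
    and "\<And>x v. x \<in> points M \<Longrightarrow> v \<in> tangent_space M x \<Longrightarrow> differential N F x v = 0"
  shows "F constant_on points M"
  by (rule connected_space_locally_constant[OF assms(4)])
    (metis differential_zero_imp_locally_constant[OF assms(1-3,5)])


section \<open>The algebra of the two structures\<close>

text \<open>The argument on a single tangent space \<open>T\<close>. The identity \<eta> o \<phi> =
  0 is derived here from the formula for the square of \<phi> and
  \<open>\<eta> \<xi> = 1\<close>.\<close>

lemma paracontact_metallic_vector_zero:
  fixes \<phi> :: "'v::real_vector \<Rightarrow> 'v" and \<eta> :: "'v \<Rightarrow> real" and p q :: real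
  assumes \<phi>: "linear_within T \<phi>" "\<phi> ` T \<subseteq> T" and \<eta>: "linear_within T \<eta>"
    and sq: "\<And>v. v \<in> T \<Longrightarrow> \<phi> (\<phi> v) = v - \<eta> v *\<^sub>R \<xi>"
    and \<xi>: "\<xi> \<in> T" "\<eta> \<xi> = 1"
    and w: "w \<in> T" "\<phi> (\<phi> w) = p *\<^sub>R \<phi> w + q *\<^sub>R w"
    and pq: "q \<noteq> 0" "p\<^sup>2 \<noteq> (q - 1)\<^sup>2"
  shows "w = 0"
proof -
  have \<phi>_lin: "\<phi> (a *\<^sub>R u + b *\<^sub>R v) = a *\<^sub>R \<phi> u + b *\<^sub>R \<phi> v"
    and \<eta>_lin: "\<eta> (a *\<^sub>R u + b *\<^sub>R v) = a * \<eta> u + b * \<eta> v" if "u \<in> T" "v \<in> T" for a b u v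
    using that \<phi>(1) \<eta> by (simp_all add: linear_within_def)
  have \<phi>T: "\<phi> v \<in> T" if "v \<in> T" for v using that \<phi>(2) by blast
  have \<xi>_nz: "\<xi> \<noteq> 0" using \<eta>_lin[OF \<xi>(1) \<xi>(1), of 0 0] \<xi>(2) by auto
  \<comment> \<open>The cube of \<open>\<phi>\<close> at \<open>v\<close> is computed in two ways,
    as the square at \<open>\<phi> v\<close> and as \<open>\<phi>\<close> of the square at
    \<open>v\<close>.\<close>
  have comm: "\<eta> (\<phi> v) *\<^sub>R \<xi> = \<eta> v *\<^sub>R \<phi> \<xi>" if "v \<in> T" for v
  proof -
    have "\<phi> v - \<eta> (\<phi> v) *\<^sub>R \<xi> = \<phi> (\<phi> (\<phi> v))" using sq[OF \<phi>T[OF that]] by simp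
    \<comment> \<open>The difference is written as a combination with two coefficients, the form in
      which \<open>linear_within\<close> applies.\<close>
    also have "\<dots> = \<phi> (1 *\<^sub>R v + (- \<eta> v) *\<^sub>R \<xi>)" using sq[OF that] by simp
    also have "\<dots> = \<phi> v - \<eta> v *\<^sub>R \<phi> \<xi>" by (subst \<phi>_lin[OF that \<xi>(1)]) simp
    finally show ?thesis by simp
  qed
  \<comment> \<open>\<open>\<phi> \<xi>\<close> is a multiple \<open>c \<xi>\<close>, and \<open>\<phi>\<^sup>2 \<xi> = 0\<close> forces \<open>c\<^sup>2 = 0\<close>.\<close>
  define c where "c = \<eta> (\<phi> \<xi>)"
  have c: "\<phi> \<xi> = c *\<^sub>R \<xi>" using comm[OF \<xi>(1)] \<xi>(2) by (simp add: c_def)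
  have "\<phi> (c *\<^sub>R \<xi> + 0 *\<^sub>R \<xi>) = 0" using sq[OF \<xi>(1)] \<xi>(2) c by simp
  then have "c = 0"
    by (subst (asm) \<phi>_lin[OF \<xi>(1) \<xi>(1)]) (use \<xi>_nz c in auto)
  then have \<eta>\<phi>: "\<eta> (\<phi> v) = 0" if "v \<in> T" for v
    using comm[OF that] c \<xi>_nz by simp
  have "0 = \<eta> (\<phi> (\<phi> w))" using \<eta>\<phi>[OF \<phi>T[OF w(1)]] by simp
  also have "\<dots> = q * \<eta> w"
    unfolding w(2) using \<eta>_lin[OF \<phi>T[OF w(1)] w(1)] \<eta>\<phi>[OF w(1)] by simp
  finally have sq_w: "\<phi> (\<phi> w) = w" using sq[OF w(1)] pq(1) by simp
  \<comment> \<open>Facts 1 and 2 express \<open>p\<close> times \<phi>(w) through \<open>w\<close>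
    and \<open>p\<close> times \<open>w\<close> through \<phi>(w), with the same factor
    \<open>1 - q\<close>; eliminating \<phi>(w) leaves only the squares of \<open>p\<close> and
    \<open>q - 1\<close>.\<close>
  then have 1: "p *\<^sub>R \<phi> w = (1 - q) *\<^sub>R w"
    using w(2) by (simp add: algebra_simps)
  have "\<phi> w = \<phi> (p *\<^sub>R \<phi> w + q *\<^sub>R w)" using sq_w w(2) by simp
  also have "\<dots> = p *\<^sub>R w + q *\<^sub>R \<phi> w"
    using \<phi>_lin[OF \<phi>T[OF w(1)] w(1)] sq_w by simp
  finally have 2: "p *\<^sub>R w = (1 - q) *\<^sub>R \<phi> w"
    by (simp add: algebra_simps)
  have "p\<^sup>2 *\<^sub>R w = p *\<^sub>R (p *\<^sub>R w)" by (simp add: power2_eq_square)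
  also have "\<dots> = (1 - q) *\<^sub>R (p *\<^sub>R \<phi> w)" by (simp add: 2 mult.commute)
  also have "\<dots> = (q - 1)\<^sup>2 *\<^sub>R w" by (simp add: 1 power2_commute[of q 1]) (simp add: power2_eq_square)
  finally show ?thesis using pq(2) by simp
qed

theorem theorem4p11:
  fixes M\<^sub>1 :: "('a, 'e::real_normed_vector) manifold"
    and g\<^sub>1 :: "'a \<Rightarrow> 'a tvec \<Rightarrow> 'a tvec \<Rightarrow> real"
    and J\<^sub>1 :: "'a \<Rightarrow> 'a tvec \<Rightarrow> 'a tvec"
    and nabla :: "'a connection"
    and N' :: "('b, 'f::euclidean_space) manifold"
    and \<phi>' :: "'b \<Rightarrow> 'b tvec \<Rightarrow> 'b tvec"
    and \<xi>' :: "'b \<Rightarrow> 'b tvec"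
    and \<eta>' :: "'b \<Rightarrow> 'b tvec \<Rightarrow> real"
    and g' :: "'b \<Rightarrow> 'b tvec \<Rightarrow> 'b tvec \<Rightarrow> real"
    and F :: "'a \<Rightarrow> 'b"
    and p q n :: nat
  assumes "metallic_riemannian M\<^sub>1 g\<^sub>1 J\<^sub>1 p q"
    and "levi_civita M\<^sub>1 g\<^sub>1 nabla"
    and "parallel11 M\<^sub>1 nabla J\<^sub>1"
    and "connected_space (mtop M\<^sub>1)"
    and "almost_paracontact_metric n N' \<phi>' \<xi>' \<eta>' g'"
    and "smooth_map M\<^sub>1 N' F"
    and "\<forall>x\<in>points M\<^sub>1. \<forall>v\<in>tangent_space M\<^sub>1 x.
           differential N' F x (J\<^sub>1 x v) = \<phi>' (F x) (differential N' F x v)"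
    and "(real p)\<^sup>2 \<noteq> (real q - 1)\<^sup>2"
  shows "F constant_on points M\<^sub>1"
proof -
  obtain m where M: "smooth_manifold m M\<^sub>1"
    using assms(1) by (auto simp: metallic_riemannian_def)
  have N: "smooth_manifold (2 * n + 1) N'"
    using assms(5) by (simp add: almost_paracontact_metric_def)
  have "differential N' F x v = 0" if x: "x \<in> points M\<^sub>1" and v: "v \<in> tangent_space M\<^sub>1 x" for x v
  proof (rule paracontact_metallic_vector_zero)
    have Fx: "F x \<in> points N'"
      using assms(6) x by (auto simp: smooth_map_def continuous_map_def)
    \<comment> \<open>Tangency of the image allows the intertwining relation to be used a second
      time, at \<open>J\<^sub>1 x v\<close>.\<close>
    have Jv: "J\<^sub>1 x v \<in> tangent_space M\<^sub>1 x"
      using assms(1) v unfolding metallic_riemannian_def tensor11_def by blast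
    show "linear_within (tangent_space N' (F x)) (\<phi>' (F x))"
      "\<phi>' (F x) ` tangent_space N' (F x) \<subseteq> tangent_space N' (F x)"
      "linear_within (tangent_space N' (F x)) (\<eta>' (F x))"
      using assms(5) Fx
      unfolding almost_paracontact_metric_def tensor11_def one_form_def by blast+
    show "\<phi>' (F x) (\<phi>' (F x) u) = u - \<eta>' (F x) u *\<^sub>R \<xi>' (F x)"
      if "u \<in> tangent_space N' (F x)" for u
      using assms(5) Fx that unfolding almost_paracontact_metric_def by blast
    show "\<xi>' (F x) \<in> tangent_space N' (F x)" "\<eta>' (F x) (\<xi>' (F x)) = 1"
      using assms(5) Fx unfolding almost_paracontact_metric_def vector_fields_def by blast+
    show "differential N' F x v \<in> tangent_space N' (F x)"
      by (rule differential_in_tangent_space[OF M N assms(6) x v])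
    have "\<phi>' (F x) (\<phi>' (F x) (differential N' F x v)) = differential N' F x (J\<^sub>1 x (J\<^sub>1 x v))"
      using assms(7) x v Jv by simp
    also have "J\<^sub>1 x (J\<^sub>1 x v) = real p *\<^sub>R J\<^sub>1 x v + real q *\<^sub>R v"
      using assms(1) x v unfolding metallic_riemannian_def by blast
    \<comment> \<open>Tangent vectors are functionals with pointwise operations, so linearity of the
      differential is seen by evaluating both sides at a function.\<close>
    also have "differential N' F x \<dots>
        = real p *\<^sub>R differential N' F x (J\<^sub>1 x v) + real q *\<^sub>R differential N' F x v"
      by (auto simp: differential_def scaleR_fun_def fun_eq_iff)
    finally show "\<phi>' (F x) (\<phi>' (F x) (differential N' F x v))
        = real p *\<^sub>R \<phi>' (F x) (differential N' F x v) + real q *\<^sub>R differential N' F x v"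
      using assms(7) x v by simp
    show "real q \<noteq> 0" using assms(1) by (simp add: metallic_riemannian_def)
    show "(real p)\<^sup>2 \<noteq> (real q - 1)\<^sup>2" by fact
  qed
  then show ?thesis
    by (rule constant_on_if_differential_zero[OF M N assms(6,4)])
qed

end
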